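(* There exist universal constants $0<c\le C$ such that for every $n\ge1$, $a\in\mathbb{R}^n$ and $t\in\mathbb{R}$, letting $f,g:\{-1,1\}^n\to\{0,1\}$ be the halfspace $f(x)=\mathbf{1}\left(\sum_i a_ix_i>t\right)$ and the dual halfspace $g(x)=\mathbf{1}\left(\sum_i a_ix_i\ge -t\right)$, we have $$c\,\varphi\left(\sum_{i=1}^n\hat f(\{i\})\hat g(\{i\})\right)\;\le\;\mathrm{Cov}(f,g)\;\le\; C\,\varphi\left(\sum_{i=1}^n\hat f(\{i\})\hat g(\{i\})\right),$$ where $\varphi(x)=x/\log(e/x)$.
   Context: Expectations are with respect to the uniform measure on $\{-1,1\}^n$; $\mathrm{Cov}(f,g)=\mathbb{E}[fg]-\mathbb{E}[f]\mathbb{E}[g]$; $\hat f(\{i\})=\mathbb{E}[f(x)x_i]$. $\log$ is the natural logarithm, and $\varphi(0)$ is interpreted as $0$. *)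

theory Defs
  imports "HOL-Probability.Probability"
begin

text \<open>Points of \<open>{-1,1}\<^sup>n\<close> are extensional functions on the index set \<open>{1..n}\<close>, so that
  \<open>n\<close> can be quantified inside a formula. A vector of \<open>\<real>\<^sup>n\<close> is given by a function
  \<open>nat \<Rightarrow> real\<close> of which only the values on \<open>{1..n}\<close> are used.\<close>

definition cube :: "nat \<Rightarrow> (nat \<Rightarrow> real) set" where
  "cube n = {1..n} \<rightarrow>\<^sub>E {-1, 1}"

definition cube_expect :: "nat \<Rightarrow> ((nat \<Rightarrow> real) \<Rightarrow> real) \<Rightarrow> real" where
  "cube_expect n f = measure_pmf.expectation (pmf_of_set (cube n)) f"

definition cube_cov :: "nat \<Rightarrow> ((nat \<Rightarrow> real) \<Rightarrow> real) \<Rightarrow> ((nat \<Rightarrow> real) \<Rightarrow> real) \<Rightarrow> real" where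
  "cube_cov n f g = cube_expect n (\<lambda>x. f x * g x) - cube_expect n f * cube_expect n g"

definition fourier1 :: "nat \<Rightarrow> ((nat \<Rightarrow> real) \<Rightarrow> real) \<Rightarrow> nat \<Rightarrow> real" where
  "fourier1 n f i = cube_expect n (\<lambda>x. f x * x i)"

definition halfspace :: "nat \<Rightarrow> (nat \<Rightarrow> real) \<Rightarrow> real \<Rightarrow> (nat \<Rightarrow> real) \<Rightarrow> real" where
  "halfspace n a t x = of_bool ((\<Sum>i = 1..n. a i * x i) > t)"

definition dual_halfspace :: "nat \<Rightarrow> (nat \<Rightarrow> real) \<Rightarrow> real \<Rightarrow> (nat \<Rightarrow> real) \<Rightarrow> real" where
  "dual_halfspace n a t x = of_bool ((\<Sum>i = 1..n. a i * x i) \<ge> - t)"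

definition \<phi> :: "real \<Rightarrow> real" where
  "\<phi> x = (if x = 0 then 0 else x / ln (exp 1 / x))"

end

theory Submission
  imports Defs
begin

text \<open>
Write \<open>Y(x) = \<Sum>i a\<^sub>i x\<^sub>i\<close> and let \<open>h\<close> be the pointwise smaller of \<open>f\<close> and \<open>g\<close>: \<open>f\<close> if \<open>t \<ge> 0\<close>,
and \<open>g\<close> otherwise. Since \<open>g(x) = 1 - f(-x)\<close>, the two halfspaces have the same level-1 coefficients
and their means add up to 1, while \<open>f g = h\<close>. Hence, with \<open>p\<close> the mean of \<open>h\<close>, the covariance is
\<open>p - p (1 - p) = p\<^sup>2\<close>, and the argument of \<open>\<phi>\<close> is \<open>W = p\<^sup>2 S\<close>, where \<open>S = |\<mu>|\<^sup>2\<close> and \<open>\<mu>\<close> is the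
mean of a uniform point conditioned on \<open>h = 1\<close>. As \<open>\<phi>(W) = p\<^sup>2 S / ln (e / (p\<^sup>2 S))\<close>, everything comes
down to showing that \<open>S\<close> is of order \<open>ln (e / p)\<close> when \<open>p > 0\<close>; if \<open>p = 0\<close>, both sides vanish.

The upper bound on \<open>S\<close> is the level-1 inequality (\<open>level_one_inequality\<close>), valid for every function
with values in \<open>[0,1]\<close>: by Jensen, \<open>p exp S \<le> E[h exp (\<mu> \<cdot> x)] \<le> E[exp (\<mu> \<cdot> x)] \<le> exp (S/2)\<close>.

The lower bound uses that \<open>h\<close> is a halfspace, and changes the measure to a product measure
(\<open>log_inverse_probability_le\<close>). Let \<open>m\<close> agree with \<open>\<mu>\<close> in the coordinates where \<open>|\<mu>\<^sub>i| \<le> 1/2\<close>, and be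
the sign of \<open>a\<^sub>i\<close> (or 1 if \<open>a\<^sub>i = 0\<close>) elsewhere, so that \<open>|m|\<^sup>2 \<le> 4 S\<close>. Under the product measure \<open>\<nu>\<close> with mean \<open>m\<close>, the
expectation of \<open>Y\<close> is at least \<open>a \<cdot> \<mu>\<close>, which is the mean of \<open>Y\<close> conditioned on \<open>h = 1\<close> and so is at
least the threshold. The centred sum \<open>Y - E Y\<close> has fourth moment at most three times its squared
variance, because a coordinate is either frozen or only moderately biased; so it is nonnegative with
probability bounded below (\<open>biased_nonneg_probability\<close>), and \<open>\<nu>(h = 1)\<close> is bounded below. On the other
hand \<open>\<nu>\<close> has density \<open>\<Prod>i (1 + m\<^sub>i x\<^sub>i)\<close>, whose second moment is at most \<open>exp (|m|\<^sup>2)\<close>, and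
Cauchy-Schwarz gives \<open>\<nu>(h = 1)\<^sup>2 \<le> p exp (4 S)\<close>. This proves \<open>S \<ge> ln (1/p) / 4 - const\<close>.

When \<open>p\<close> is not small this says nothing, and one needs in addition that \<open>S\<close> is bounded below by an
absolute constant (\<open>cond_mean_norm_ge\<close>); that follows by testing \<open>\<mu>\<close> against the direction \<open>a\<close>, using
the Khinchine inequality for \<open>E|Y|\<close>.
\<close>

section \<open>Sums over the cube\<close>

lemma finite_cube [simp]: "finite (cube n)"
  by (simp add: cube_def finite_PiE)

lemma cube_nonempty: "cube n \<noteq> {}"
  by (simp add: cube_def PiE_eq_empty_iff)

lemma card_cube: "card (cube n) = 2 ^ n"
  by (simp add: cube_def card_PiE flip: numeral_2_eq_2)

lemma cube_coordinate: "x \<in> cube n \<Longrightarrow> i \<in> {1..n} \<Longrightarrow> x i = -1 \<or> x i = 1"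
  by (auto simp: cube_def PiE_iff)

lemma cube_expect_eq_sum: "cube_expect n F = (\<Sum>x\<in>cube n. F x) / 2 ^ n"
  unfolding cube_expect_def
  by (subst integral_pmf_of_set) (simp_all add: cube_nonempty card_cube)

lemma sum_cube_prod:
  fixes F :: "nat \<Rightarrow> real \<Rightarrow> real"
  shows "(\<Sum>x\<in>cube n. \<Prod>i=1..n. F i (x i)) = (\<Prod>i=1..n. F i (-1) + F i 1)"
  unfolding cube_def by (subst prod_sum_PiE [symmetric]) simp_all

lemma sum_cube_Suc:
  fixes F :: "(nat \<Rightarrow> real) \<Rightarrow> real"
  shows "(\<Sum>x\<in>cube (Suc n). F x) = (\<Sum>x\<in>cube n. F (x(Suc n := -1)) + F (x(Suc n := 1)))"
proof -
  have "cube (Suc n) = (\<lambda>(y, x). x(Suc n := y)) ` ({-1, 1} \<times> cube n)"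
    unfolding cube_def by (subst atLeastAtMostSuc_conv) (simp_all add: PiE_insert_eq)
  moreover have "inj_on (\<lambda>(y, x). x(Suc n := y)) ({-1, 1} \<times> cube n)"
    unfolding cube_def by (rule inj_combinator [of "Suc n" "{1..n}" "\<lambda>_. {-1, 1}"]) simp
  ultimately have "(\<Sum>x\<in>cube (Suc n). F x) = (\<Sum>(y, x)\<in>{-1, 1} \<times> cube n. F (x(Suc n := y)))"
    by (simp add: sum.reindex case_prod_unfold)
  also have "\<dots> = (\<Sum>y\<in>{-1, 1}. \<Sum>x\<in>cube n. F (x(Suc n := y)))"
    by (rule sum.cartesian_product [symmetric])
  finally show ?thesis
    by (simp add: sum.distrib)
qed

lemma reflect_in_cube: "x \<in> cube n \<Longrightarrow> (\<lambda>i\<in>{1..n}. - x i) \<in> cube n"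
  using cube_coordinate [of x n] by (fastforce simp: cube_def PiE_iff)

lemma cube_expect_reflect: "cube_expect n (\<lambda>x. F (\<lambda>i\<in>{1..n}. - x i)) = cube_expect n F"
proof -
  have invol: "(\<lambda>i\<in>{1..n}. - (\<lambda>i\<in>{1..n}. - x i) i) = x" if "x \<in> cube n" for x
    using that by (auto simp: cube_def PiE_iff extensional_def)
  have "(\<Sum>x\<in>cube n. F (\<lambda>i\<in>{1..n}. - x i)) = (\<Sum>x\<in>cube n. F x)"
    by (rule sum.reindex_bij_witness
          [where i = "\<lambda>x. \<lambda>i\<in>{1..n}. - x i" and j = "\<lambda>x. \<lambda>i\<in>{1..n}. - x i"])
       (simp_all only: reflect_in_cube invol)
  then show ?thesis
    by (simp add: cube_expect_eq_sum)
qed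

lemma cube_expect_mono: "(\<And>x. x \<in> cube n \<Longrightarrow> F x \<le> G x) \<Longrightarrow> cube_expect n F \<le> cube_expect n G"
  by (simp add: cube_expect_eq_sum divide_right_mono sum_mono)

lemma cube_expect_cong: "(\<And>x. x \<in> cube n \<Longrightarrow> F x = G x) \<Longrightarrow> cube_expect n F = cube_expect n G"
  by (simp add: cube_expect_eq_sum)

lemma cube_expect_add: "cube_expect n (\<lambda>x. F x + G x) = cube_expect n F + cube_expect n G"
  by (simp add: cube_expect_eq_sum sum.distrib add_divide_distrib)

lemma cube_expect_cmult: "cube_expect n (\<lambda>x. c * F x) = c * cube_expect n F"
  by (simp add: cube_expect_eq_sum sum_distrib_left [symmetric])

lemma cube_expect_const: "cube_expect n (\<lambda>x. c) = c"
  by (simp add: cube_expect_eq_sum card_cube)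

lemma cube_expect_linear_form:
  "cube_expect n (\<lambda>x. F x * (\<Sum>i=1..n. a i * x i)) = (\<Sum>i=1..n. a i * fourier1 n F i)"
proof -
  have "(\<Sum>x\<in>cube n. F x * (\<Sum>i=1..n. a i * x i)) = (\<Sum>i=1..n. \<Sum>x\<in>cube n. a i * (F x * x i))"
    by (simp add: sum_distrib_left algebra_simps) (rule sum.swap)
  then show ?thesis
    by (simp add: fourier1_def cube_expect_eq_sum sum_distrib_left sum_divide_distrib)
qed

section \<open>Biased product measures\<close>

text \<open>For \<open>|m\<^sub>i| \<le> 1\<close> this is the expectation when the coordinates are independent and \<open>x\<^sub>i\<close> has mean
  \<open>m\<^sub>i\<close>. It is written through the density with respect to the uniform measure, which makes sense
  for \<open>m\<^sub>i = \<plusminus>1\<close> as well, where the coordinate is frozen, and is what the change of measure uses.\<close>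

definition biased_expect :: "nat \<Rightarrow> (nat \<Rightarrow> real) \<Rightarrow> ((nat \<Rightarrow> real) \<Rightarrow> real) \<Rightarrow> real" where
  "biased_expect n m F = cube_expect n (\<lambda>x. (\<Prod>i=1..n. 1 + m i * x i) * F x)"

lemma biased_expect_zero: "biased_expect n (\<lambda>_. 0) F = cube_expect n F"
  by (simp add: biased_expect_def)

text \<open>Averaging over the last coordinate first; the moment computations are inductions along this
  identity.\<close>

lemma biased_expect_Suc:
  "biased_expect (Suc n) m F =
     biased_expect n m (\<lambda>x. (1 - m (Suc n)) / 2 * F (x(Suc n := -1))
                          + (1 + m (Suc n)) / 2 * F (x(Suc n := 1)))"
  unfolding biased_expect_def cube_expect_eq_sum sum_cube_Suc
  by (simp add: sum_divide_distrib) (rule sum.cong, simp_all add: field_simps)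

lemma biased_expect_add:
  "biased_expect n m (\<lambda>x. F x + G x) = biased_expect n m F + biased_expect n m G"
  by (simp add: biased_expect_def distrib_left cube_expect_add)

lemma biased_expect_cmult: "biased_expect n m (\<lambda>x. c * F x) = c * biased_expect n m F"
  by (simp add: biased_expect_def mult.left_commute [of _ c] cube_expect_cmult)

lemma biased_expect_one: "biased_expect n m (\<lambda>x. 1) = 1"
  using sum_cube_prod [of "\<lambda>i y. 1 + m i * y" n]
  by (simp add: biased_expect_def cube_expect_eq_sum)

lemma biased_weight_nonneg:
  assumes "\<And>i. i \<in> {1..n} \<Longrightarrow> \<bar>m i\<bar> \<le> 1" and "x \<in> cube n"
  shows "0 \<le> (\<Prod>i=1..n. 1 + m i * x i)"
proof (rule prod_nonneg)
  fix i assume i: "i \<in> {1..n}"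
  show "0 \<le> 1 + m i * x i"
    using assms(1) [OF i] cube_coordinate [OF assms(2) i] by auto
qed

lemma biased_expect_mono:
  assumes "\<And>i. i \<in> {1..n} \<Longrightarrow> \<bar>m i\<bar> \<le> 1"
    and "\<And>x. x \<in> cube n \<Longrightarrow> F x \<le> G x"
  shows "biased_expect n m F \<le> biased_expect n m G"
  unfolding biased_expect_def
  by (intro cube_expect_mono mult_left_mono biased_weight_nonneg assms)

text \<open>The change of measure: the density has second moment \<open>\<Prod>i (1 + m\<^sub>i\<^sup>2) \<le> exp (|m|\<^sup>2)\<close>, so an event
  that is likely under the biased measure cannot have too small a uniform probability.\<close>

lemma biased_expect_Cauchy_Schwarz:
  "(biased_expect n m F)\<^sup>2 \<le> cube_expect n (\<lambda>x. (F x)\<^sup>2) * exp (\<Sum>i=1..n. (m i)\<^sup>2)"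
proof -
  have "(\<Sum>x\<in>cube n. (\<Prod>i=1..n. 1 + m i * x i) * F x)\<^sup>2
      \<le> (\<Sum>x\<in>cube n. (\<Prod>i=1..n. 1 + m i * x i)\<^sup>2) * (\<Sum>x\<in>cube n. (F x)\<^sup>2)"
    by (rule Cauchy_Schwarz_ineq_sum)
  also have "(\<Sum>x\<in>cube n. (\<Prod>i=1..n. 1 + m i * x i)\<^sup>2) = (\<Prod>i=1..n. 2 * (1 + (m i)\<^sup>2))"
  proof -
    have "(1 - m i)\<^sup>2 + (1 + m i)\<^sup>2 = 2 * (1 + (m i)\<^sup>2)" for i
      by (simp add: power2_eq_square algebra_simps)
    with sum_cube_prod [of "\<lambda>i y. (1 + m i * y)\<^sup>2" n] show ?thesis
      by (simp add: prod_power_distrib)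
  qed
  also have "\<dots> = 2 ^ n * (\<Prod>i=1..n. 1 + (m i)\<^sup>2)"
    unfolding prod.distrib by simp
  also have "\<dots> \<le> 2 ^ n * exp (\<Sum>i=1..n. (m i)\<^sup>2)"
    by (auto simp: exp_sum intro!: prod_mono)
  finally have "(\<Sum>x\<in>cube n. (\<Prod>i=1..n. 1 + m i * x i) * F x)\<^sup>2
      \<le> 2 ^ n * exp (\<Sum>i=1..n. (m i)\<^sup>2) * (\<Sum>x\<in>cube n. (F x)\<^sup>2)"
    by (simp add: sum_nonneg mult_right_mono)
  then show ?thesis
    by (simp add: biased_expect_def cube_expect_eq_sum field_simps power2_eq_square)
qed

section \<open>Moments of a weighted sum of independent signs\<close>

definition centred_form :: "nat \<Rightarrow> (nat \<Rightarrow> real) \<Rightarrow> (nat \<Rightarrow> real) \<Rightarrow> (nat \<Rightarrow> real) \<Rightarrow> real" where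
  "centred_form n a m x = (\<Sum>i=1..n. a i * (x i - m i))"

lemma biased_expect_centred_Suc:
  "biased_expect (Suc n) m (\<lambda>x. h (centred_form (Suc n) a m x)) =
     biased_expect n m (\<lambda>x.
         (1 - m (Suc n)) / 2 * h (centred_form n a m x - a (Suc n) * (1 + m (Suc n)))
       + (1 + m (Suc n)) / 2 * h (centred_form n a m x + a (Suc n) * (1 - m (Suc n))))"
proof -
  have "centred_form (Suc n) a m (x(Suc n := y)) = centred_form n a m x + a (Suc n) * (y - m (Suc n))"
    for x y
    by (simp add: centred_form_def)
  moreover have "-1 - m (Suc n) = - (1 + m (Suc n))"
    by simp
  ultimately show ?thesis
    by (subst biased_expect_Suc) (simp only: mult_minus_right diff_conv_add_uminus)
qed

lemma biased_first_moment: "biased_expect n m (centred_form n a m) = 0"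
proof (induction n)
  case 0
  then show ?case
    by (simp add: biased_expect_def cube_expect_eq_sum centred_form_def)
next
  case (Suc n)
  have "biased_expect (Suc n) m (centred_form (Suc n) a m) = biased_expect n m (centred_form n a m)"
    using biased_expect_centred_Suc [of n m "\<lambda>z. z" a] by (simp add: field_simps)
  then show ?case
    using Suc by simp
qed

lemma biased_second_moment:
  "biased_expect n m (\<lambda>x. (centred_form n a m x)\<^sup>2) = (\<Sum>i=1..n. (a i)\<^sup>2 * (1 - (m i)\<^sup>2))"
proof (induction n)
  case 0
  then show ?case
    by (simp add: biased_expect_def cube_expect_eq_sum centred_form_def)
next
  case (Suc n)
  let ?a = "a (Suc n)" and ?m = "m (Suc n)"
  have alg: "(1 - ?m) / 2 * (z - ?a * (1 + ?m))\<^sup>2 + (1 + ?m) / 2 * (z + ?a * (1 - ?m))\<^sup>2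
      = z\<^sup>2 + ?a\<^sup>2 * (1 - ?m\<^sup>2) * 1" for z
    by (simp add: power2_eq_square field_simps)
  show ?case
    unfolding biased_expect_centred_Suc [of n m "\<lambda>z. z\<^sup>2"] alg
      biased_expect_add biased_expect_cmult biased_expect_one Suc
    by simp
qed

text \<open>For a single term \<open>a (x - m)\<close> the fourth moment exceeds the squared variance by the factor
  \<open>(1 + 3 m\<^sup>2) / (1 - m\<^sup>2)\<close>. It is unbounded as \<open>m\<close> approaches \<open>\<plusminus>1\<close>, but at most \<open>7/3 < 3\<close> when
  \<open>|m| \<le> 1/2\<close>, and both moments vanish when \<open>|m| = 1\<close>. The constant 3 is preserved by sums of
  independent centred terms, since the mixed terms contribute \<open>6 v V\<close>.\<close>

lemma biased_fourth_moment:
  assumes "\<And>i. i \<in> {1..n} \<Longrightarrow> \<bar>m i\<bar> \<le> 1/2 \<or> \<bar>m i\<bar> = 1"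
  shows "biased_expect n m (\<lambda>x. (centred_form n a m x)^4) \<le> 3 * (\<Sum>i=1..n. (a i)\<^sup>2 * (1 - (m i)\<^sup>2))\<^sup>2"
  using assms
proof (induction n)
  case 0
  then show ?case
    by (simp add: biased_expect_def cube_expect_eq_sum centred_form_def)
next
  case (Suc n)
  let ?a = "a (Suc n)" and ?m = "m (Suc n)"
  define V where "V = (\<Sum>i=1..n. (a i)\<^sup>2 * (1 - (m i)\<^sup>2))"
  define v where "v = ?a\<^sup>2 * (1 - ?m\<^sup>2)"
  define k where "k = ?a ^ 4 * (1 - ?m\<^sup>2) * (1 + 3 * ?m\<^sup>2)"
  have alg: "(1 - ?m) / 2 * (z - ?a * (1 + ?m))^4 + (1 + ?m) / 2 * (z + ?a * (1 - ?m))^4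
      = z ^ 4 + (6 * v) * z\<^sup>2 + (- 8 * ?a ^ 3 * ?m * (1 - ?m\<^sup>2)) * z + k * 1" for z
    unfolding v_def k_def by (simp add: power2_eq_square power3_eq_cube power4_eq_xxxx field_simps)
  have "biased_expect (Suc n) m (\<lambda>x. (centred_form (Suc n) a m x)^4)
      = biased_expect n m (\<lambda>x. (centred_form n a m x)^4) + 6 * v * V + k"
    unfolding biased_expect_centred_Suc [of n m "\<lambda>z. z^4"] alg
      biased_expect_add biased_expect_cmult biased_expect_one biased_second_moment
      biased_first_moment V_def by simp
  moreover have "biased_expect n m (\<lambda>x. (centred_form n a m x)^4) \<le> 3 * V\<^sup>2"
    unfolding V_def by (rule Suc.IH) (use Suc.prems in simp)
  moreover have "k \<le> 3 * v\<^sup>2"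
  proof -
    have "\<bar>?m\<bar> \<le> 1/2 \<or> \<bar>?m\<bar> = 1"
      using Suc.prems by simp
    then have "?m\<^sup>2 \<le> 1/4 \<or> ?m\<^sup>2 = 1"
      using abs_le_square_iff [of ?m "1/2"] by (auto simp: power2_eq_square abs_square_eq_1 abs_if split: if_splits)
    then have "(1 - ?m\<^sup>2) * (1 + 3 * ?m\<^sup>2) \<le> 3 * (1 - ?m\<^sup>2)\<^sup>2"
    proof
      assume "?m\<^sup>2 \<le> 1/4"
      then have "0 \<le> (1 - ?m\<^sup>2) * (2 - 6 * ?m\<^sup>2)"
        by (intro mult_nonneg_nonneg) auto
      then show ?thesis
        by (simp add: power2_eq_square algebra_simps)
    qed simp
    from mult_left_mono [OF this, of "?a ^ 4"] show ?thesis
      by (simp add: k_def v_def power_mult_distrib mult.assoc flip: power_mult)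
  qed
  ultimately have "biased_expect (Suc n) m (\<lambda>x. (centred_form (Suc n) a m x)^4) \<le> 3 * V\<^sup>2 + 6 * v * V + 3 * v\<^sup>2"
    by linarith
  also have "\<dots> = 3 * (V + v)\<^sup>2"
    by (simp add: power2_eq_square algebra_simps)
  finally show ?case
    by (simp add: V_def v_def)
qed


text \<open>Two pointwise polynomial minorants turn the moment bounds into a first-moment and a probability
  estimate. The coefficient \<open>4/27\<close> makes \<open>1 - w + (4/27) w\<^sup>3\<close> have a double root, at \<open>w = 3/2\<close>. For the
  indicator, a linear term is available for free because it integrates to 0; it is what makes the
  minorant nonpositive on the negative half-line.\<close>

lemma abs_ge_quartic: "z\<^sup>2 - 4/27 * z^4 \<le> \<bar>z\<bar>" for z :: real
proof -
  define w where "w = \<bar>z\<bar>"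
  have "0 \<le> 4/27 * (w * ((w - 3/2)\<^sup>2 * (w + 3)))"
    by (simp add: w_def)
  also have "\<dots> = w - w\<^sup>2 + 4/27 * w^4"
    by (simp add: power2_eq_square power4_eq_xxxx algebra_simps)
  finally show ?thesis
    by (simp add: w_def)
qed

lemma of_bool_nonneg_ge_quartic: "z/4 + z\<^sup>2/4 - z^4/27 \<le> of_bool (0 \<le> z)" for z :: real
proof (cases "0 \<le> z")
  case True
  have "0 \<le> (z\<^sup>2 - 4)\<^sup>2 / 27 + 5/108 * (z - 27/10)\<^sup>2"
    by simp
  also have "\<dots> \<le> 1 - z/4 - z\<^sup>2/4 + z^4/27"
    by (simp add: power2_eq_square power4_eq_xxxx field_simps)
  finally show ?thesis
    using True by simp
next
  case False
  then show ?thesis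
    using abs_ge_quartic [of z] by simp
qed

text \<open>After rescaling to variance 1, the quartic minorant of the indicator has expectation at least
  \<open>0 + 1/4 - 3/27 = 5/36\<close>.\<close>

lemma biased_nonneg_probability:
  assumes m: "\<And>i. i \<in> {1..n} \<Longrightarrow> \<bar>m i\<bar> \<le> 1/2 \<or> \<bar>m i\<bar> = 1"
  shows "5/36 \<le> biased_expect n m (\<lambda>x. of_bool (0 \<le> centred_form n a m x))"
proof -
  define V where "V = (\<Sum>i=1..n. (a i)\<^sup>2 * (1 - (m i)\<^sup>2))"
  have m1: "\<bar>m i\<bar> \<le> 1" if "i \<in> {1..n}" for i
    using m [OF that] by auto
  have "0 \<le> V"
    unfolding V_def using m1 by (intro sum_nonneg mult_nonneg_nonneg) (auto simp: abs_square_le_1)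
  then consider "V = 0" | "V > 0"
    by linarith
  then show ?thesis
  proof cases
    case 1
    \<comment> \<open>All randomness is frozen: the centred form vanishes wherever the density does not.\<close>
    have "(\<Sum>x\<in>cube n. (\<Prod>i=1..n. 1 + m i * x i) * (centred_form n a m x)\<^sup>2) = 0"
      using biased_second_moment [of n m a] 1
      by (simp add: V_def biased_expect_def cube_expect_eq_sum)
    then have zero: "(\<Prod>i=1..n. 1 + m i * x i) * (centred_form n a m x)\<^sup>2 = 0" if "x \<in> cube n" for x
    proof (subst (asm) sum_nonneg_eq_0_iff)
      show "0 \<le> (\<Prod>i=1..n. 1 + m i * y i) * (centred_form n a m y)\<^sup>2" if "y \<in> cube n" for y
        by (intro mult_nonneg_nonneg biased_weight_nonneg m1 that zero_le_power2)
    qed (use that in simp_all)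
    have "biased_expect n m (\<lambda>x. of_bool (0 \<le> centred_form n a m x)) = biased_expect n m (\<lambda>x. 1)"
      unfolding biased_expect_def by (rule cube_expect_cong) (use zero in fastforce)
    then show ?thesis
      by (simp add: biased_expect_one)
  next
    case 2
    define s where "s = sqrt V"
    have s: "s > 0" "s\<^sup>2 = V" "s^4 = V\<^sup>2"
      using 2 by (auto simp: s_def power4_eq_xxxx power2_eq_square)
    have "(1/(4 * s)) * z + (1/(4 * V)) * z\<^sup>2 + (-1/(27 * V\<^sup>2)) * z^4 \<le> of_bool (0 \<le> z)" for z
      using of_bool_nonneg_ge_quartic [of "z/s"] s by (simp add: power_divide zero_le_divide_iff)
    then have "biased_expect n m (\<lambda>x. (1/(4 * s)) * centred_form n a m x
          + (1/(4 * V)) * (centred_form n a m x)\<^sup>2 + (-1/(27 * V\<^sup>2)) * (centred_form n a m x)^4)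
        \<le> biased_expect n m (\<lambda>x. of_bool (0 \<le> centred_form n a m x))"
      by (intro biased_expect_mono m1)
    moreover have "1/(27 * V\<^sup>2) * biased_expect n m (\<lambda>x. (centred_form n a m x)^4) \<le> 1/(27 * V\<^sup>2) * (3 * V\<^sup>2)"
      using biased_fourth_moment [of n m a, OF m] by (intro mult_left_mono) (auto simp: V_def)
    moreover have "1/(27 * V\<^sup>2) * (3 * V\<^sup>2) = 1/9" "1/(4 * V) * V = 1/4"
      using 2 by simp_all
    ultimately show ?thesis
      unfolding biased_expect_add biased_expect_cmult biased_first_moment biased_second_moment
        V_def [symmetric]
      by linarith
  qed
qed

text \<open>After rescaling to variance 1, the quartic minorant of the absolute value has expectation at
  least \<open>1 - (4/27) 3 = 5/9\<close>.\<close>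

lemma Khinchine_first_moment:
  "5/9 * sqrt (\<Sum>i=1..n. (a i)\<^sup>2) \<le> cube_expect n (\<lambda>x. \<bar>\<Sum>i=1..n. a i * x i\<bar>)"
proof -
  define V where "V = (\<Sum>i=1..n. (a i)\<^sup>2)"
  define Y where "Y = centred_form n a (\<lambda>_. 0)"
  have Y: "(\<Sum>i=1..n. a i * x i) = Y x" for x
    by (simp add: Y_def centred_form_def)
  have m2: "cube_expect n (\<lambda>x. (Y x)\<^sup>2) = V"
    using biased_second_moment [of n "\<lambda>_. 0" a] by (simp add: Y_def V_def biased_expect_zero)
  have m4: "cube_expect n (\<lambda>x. (Y x)^4) \<le> 3 * V\<^sup>2"
    using biased_fourth_moment [of n "\<lambda>_. 0" a] by (simp add: Y_def V_def biased_expect_zero)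
  have "0 \<le> V"
    unfolding V_def by (intro sum_nonneg) auto
  then consider "V = 0" | "V > 0"
    by linarith
  then have "5/9 * sqrt V \<le> cube_expect n (\<lambda>x. \<bar>Y x\<bar>)"
  proof cases
    case 1
    then show ?thesis
      by (simp add: cube_expect_eq_sum sum_nonneg)
  next
    case 2
    define s where "s = sqrt V"
    have s: "s > 0" "s\<^sup>2 = V" "s^4 = V\<^sup>2"
      using 2 by (auto simp: s_def power4_eq_xxxx power2_eq_square)
    have "(1/V) * z\<^sup>2 + (-4/(27 * V\<^sup>2)) * z^4 \<le> (1/s) * \<bar>z\<bar>" for z
      using abs_ge_quartic [of "z/s"] s by (simp add: power_divide)
    then have "cube_expect n (\<lambda>x. (1/V) * (Y x)\<^sup>2 + (-4/(27 * V\<^sup>2)) * (Y x)^4)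
        \<le> cube_expect n (\<lambda>x. (1/s) * \<bar>Y x\<bar>)"
      by (intro cube_expect_mono)
    moreover have "4/(27 * V\<^sup>2) * cube_expect n (\<lambda>x. (Y x)^4) \<le> 4/(27 * V\<^sup>2) * (3 * V\<^sup>2)"
      using m4 by (intro mult_left_mono) auto
    ultimately have "5/9 \<le> (1/s) * cube_expect n (\<lambda>x. \<bar>Y x\<bar>)"
      unfolding cube_expect_add cube_expect_cmult m2 using 2 by simp
    then show ?thesis
      using s by (simp add: field_simps flip: s_def)
  qed
  then show ?thesis
    unfolding Y V_def .
qed

section \<open>The level-1 inequality\<close>

text \<open>This is Hoeffding's lemma for a uniform sign.\<close>

lemma cosh_le_exp_half_square: "(exp (- y) + exp y) / 2 \<le> exp (y\<^sup>2 / 2)" for y :: real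
proof -
  define h where "h = 2 * \<bar>y\<bar>"
  have pos: "1 + 1/2 * (exp h - 1) > 0"
    by (simp add: field_simps add_pos_pos)
  have "- h * (1/2) + ln (1 + 1/2 * (exp h - 1)) \<le> h\<^sup>2 / 8"
    by (rule Hoeffdings_lemma_aux) (simp_all add: h_def)
  then have "exp (- h * (1/2) + ln (1 + 1/2 * (exp h - 1))) \<le> exp (h\<^sup>2 / 8)"
    by simp
  also have "exp (- h * (1/2) + ln (1 + 1/2 * (exp h - 1))) = exp (- \<bar>y\<bar>) * ((1 + exp h) / 2)"
    using pos by (subst exp_add) (simp add: h_def field_simps)
  also have "\<dots> = (exp (- \<bar>y\<bar>) + exp \<bar>y\<bar>) / 2"
    by (simp add: h_def algebra_simps flip: exp_add)
  also have "\<dots> = (exp (- y) + exp y) / 2"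
    by (cases "y \<ge> 0") simp_all
  finally show ?thesis
    by (simp add: h_def power_mult_distrib)
qed

lemma cube_expect_exp_le: "cube_expect n (\<lambda>x. exp (\<Sum>i=1..n. m i * x i)) \<le> exp ((\<Sum>i=1..n. (m i)\<^sup>2) / 2)"
proof -
  have "cube_expect n (\<lambda>x. exp (\<Sum>i=1..n. m i * x i)) = (\<Prod>i=1..n. (exp (- m i) + exp (m i)) / 2)"
    using sum_cube_prod [of "\<lambda>i y. exp (m i * y)" n]
    by (simp add: cube_expect_eq_sum exp_sum prod_dividef)
  also have "\<dots> \<le> (\<Prod>i=1..n. exp ((m i)\<^sup>2 / 2))"
    by (intro prod_mono) (use cosh_le_exp_half_square in \<open>auto simp: add_nonneg_nonneg\<close>)
  also have "\<dots> = exp ((\<Sum>i=1..n. (m i)\<^sup>2) / 2)"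
    by (simp add: exp_sum sum_divide_distrib)
  finally show ?thesis .
qed

text \<open>Here \<open>fourier1 n F i / p\<close> is the mean \<open>m\<^sub>i\<close> of the \<open>i\<close>-th coordinate under the probability
  density \<open>F / p\<close>. With \<open>S = |m|\<^sup>2\<close>, Jensen's inequality for \<open>exp\<close> at the linear form \<open>m \<cdot> x\<close>, whose mean
  under this density is \<open>S\<close>, gives \<open>p exp S \<le> E[exp (m \<cdot> x)] \<le> exp (S/2)\<close>.\<close>

lemma level_one_inequality:
  assumes F: "\<And>x. x \<in> cube n \<Longrightarrow> 0 \<le> F x \<and> F x \<le> 1"
    and p: "p = cube_expect n F" "p > 0"
  shows "(\<Sum>i=1..n. (fourier1 n F i / p)\<^sup>2) \<le> 2 * ln (1 / p)"
proof -
  define m where "m i = fourier1 n F i / p" for i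
  define S where "S = (\<Sum>i=1..n. (m i)\<^sup>2)"
  define Y where "Y x = (\<Sum>i=1..n. m i * x i)" for x :: "nat \<Rightarrow> real"
  have FY: "cube_expect n (\<lambda>x. F x * Y x) = p * S"
    unfolding Y_def cube_expect_linear_form unfolding S_def sum_distrib_left
    using p(2) by (intro sum.cong) (simp_all add: m_def power2_eq_square)
  \<comment> \<open>Jensen's inequality, in the form of the tangent line to \<open>exp\<close> at \<open>S\<close>.\<close>
  have point: "exp S * (1 - S) * F x + exp S * (F x * Y x) \<le> exp (Y x)" if "x \<in> cube n" for x
  proof -
    have "exp S * (1 - S) * F x + exp S * (F x * Y x) = F x * (exp S * (1 + (Y x - S)))"
      by (simp add: algebra_simps)
    also have "\<dots> \<le> F x * (exp S * exp (Y x - S))"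
      using F [OF that] by (intro mult_left_mono exp_ge_add_one_self) auto
    also have "\<dots> \<le> exp (Y x)"
      using F [OF that] by (simp add: mult_left_le_one_le flip: exp_add)
    finally show ?thesis .
  qed
  have "exp S * p = cube_expect n (\<lambda>x. exp S * (1 - S) * F x + exp S * (F x * Y x))"
    unfolding cube_expect_add cube_expect_cmult FY by (simp add: p(1) algebra_simps)
  also have "\<dots> \<le> cube_expect n (\<lambda>x. exp (Y x))"
    by (rule cube_expect_mono) (rule point)
  also have "\<dots> \<le> exp (S / 2)"
    unfolding Y_def S_def by (rule cube_expect_exp_le)
  finally have "ln (exp S * p) \<le> ln (exp (S / 2))"
    using p(2) by (subst ln_le_cancel_iff) auto
  then show ?thesis
    using p by (simp add: ln_mult ln_div S_def m_def)
qed

section \<open>Halfspaces attain the level-1 inequality\<close>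

text \<open>Weak inequality at a positive threshold covers both halfspaces of the theorem: on the finite
  cube a strict inequality at \<open>t \<ge> 0\<close> is a weak one at a larger number. Positivity is what
  gives the event \<open>F = 1\<close> a bias in the direction \<open>a\<close>, even when its probability is close to 1/2.\<close>

locale positive_threshold =
  fixes n :: nat and a :: "nat \<Rightarrow> real" and \<tau> :: real and F :: "(nat \<Rightarrow> real) \<Rightarrow> real" and p :: real
  assumes \<tau>_pos: "\<tau> > 0"
    and F_eq: "\<And>x. x \<in> cube n \<Longrightarrow> F x = of_bool (\<tau> \<le> (\<Sum>i=1..n. a i * x i))"
    and p_eq: "p = cube_expect n F"
    and p_pos: "p > 0"
begin

definition cond_mean :: "nat \<Rightarrow> real" where
  "cond_mean i = fourier1 n F i / p"

lemma cond_mean_dot: "p * (\<Sum>i=1..n. a i * cond_mean i) = cube_expect n (\<lambda>x. F x * (\<Sum>i=1..n. a i * x i))"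
  unfolding cube_expect_linear_form unfolding sum_distrib_left
  using p_pos by (intro sum.cong) (simp_all add: cond_mean_def)

text \<open>The right-hand side is the mean of the linear form conditioned on its being at least \<open>\<tau>\<close>.\<close>

lemma threshold_le_cond_mean_dot: "\<tau> \<le> (\<Sum>i=1..n. a i * cond_mean i)"
proof -
  have "cube_expect n (\<lambda>x. \<tau> * F x) \<le> cube_expect n (\<lambda>x. F x * (\<Sum>i=1..n. a i * x i))"
    by (rule cube_expect_mono) (auto simp: F_eq)
  then have "p * \<tau> \<le> p * (\<Sum>i=1..n. a i * cond_mean i)"
    unfolding cond_mean_dot cube_expect_cmult by (simp add: p_eq mult.commute)
  then show ?thesis
    using p_pos by simp
qed

lemma abs_cond_mean_le_1:
  assumes "i \<in> {1..n}"
  shows "\<bar>cond_mean i\<bar> \<le> 1"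
proof -
  have "F x * x i \<le> F x" "-1 * F x \<le> F x * x i" if "x \<in> cube n" for x
    using cube_coordinate [OF that assms] by (auto simp: F_eq that)
  then have "cube_expect n (\<lambda>x. F x * x i) \<le> cube_expect n F"
      "cube_expect n (\<lambda>x. -1 * F x) \<le> cube_expect n (\<lambda>x. F x * x i)"
    by (intro cube_expect_mono; simp)+
  then have "\<bar>fourier1 n F i\<bar> \<le> p"
    unfolding cube_expect_cmult fourier1_def p_eq by simp
  then show ?thesis
    using p_pos by (simp add: cond_mean_def)
qed

lemma p_le_1: "p \<le> 1"
proof -
  have "cube_expect n F \<le> cube_expect n (\<lambda>x. 1)"
    by (rule cube_expect_mono) (simp add: F_eq)
  then show ?thesis
    by (simp add: p_eq cube_expect_const)
qed

text \<open>By Cauchy-Schwarz it is enough that the conditional mean \<open>D\<close> of the linear form is at least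
  \<open>s/8\<close>, where \<open>s = |a|\<close>. If \<open>\<tau> \<ge> s/8\<close> this is \<open>D \<ge> \<tau>\<close>. If \<open>\<tau>\<close> is smaller, then by symmetry most of
  the first absolute moment, which is at least \<open>5s/9\<close>, comes from the event and its reflection.\<close>

lemma cond_mean_norm_ge: "1/64 \<le> (\<Sum>i=1..n. (cond_mean i)\<^sup>2)"
proof -
  define s where "s = sqrt (\<Sum>i=1..n. (a i)\<^sup>2)"
  define D where "D = (\<Sum>i=1..n. a i * cond_mean i)"
  have s2: "s\<^sup>2 = (\<Sum>i=1..n. (a i)\<^sup>2)"
    by (simp add: s_def sum_nonneg)
  have CS: "D\<^sup>2 \<le> s\<^sup>2 * (\<Sum>i=1..n. (cond_mean i)\<^sup>2)"
    unfolding s2 D_def by (rule Cauchy_Schwarz_ineq_sum)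
  have D: "\<tau> \<le> D"
    unfolding D_def by (rule threshold_le_cond_mean_dot)
  have "s \<noteq> 0"
    using CS D \<tau>_pos by auto
  then have s: "s > 0"
    by (simp add: s_def less_le sum_nonneg)
  have "s / 8 \<le> D"
  proof (cases "s / 8 \<le> \<tau>")
    case False
    define Y where "Y x = (\<Sum>i=1..n. a i * x i)" for x :: "nat \<Rightarrow> real"
    let ?r = "\<lambda>x. \<lambda>i\<in>{1..n}. - x i :: real"
    have Yr: "Y (?r x) = - Y x" for x
      by (simp add: Y_def sum_negf)
    have "\<bar>Y x\<bar> \<le> \<tau> + (F x * Y x + F (?r x) * Y (?r x))" if "x \<in> cube n" for x
      unfolding F_eq [OF that] F_eq [OF reflect_in_cube [OF that]] unfolding Y_def [symmetric] Yr
      using \<tau>_pos by auto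
    then have "cube_expect n (\<lambda>x. \<bar>Y x\<bar>) \<le> cube_expect n (\<lambda>x. \<tau> + (F x * Y x + F (?r x) * Y (?r x)))"
      by (rule cube_expect_mono)
    also have "\<dots> = \<tau> + 2 * (p * D)"
      using cube_expect_reflect [of n "\<lambda>x. F x * Y x"] cond_mean_dot
      by (simp add: cube_expect_add cube_expect_const D_def Y_def)
    finally have "5/9 * s \<le> \<tau> + 2 * (p * D)"
      using Khinchine_first_moment [of a n] by (simp add: s_def Y_def)
    moreover have "p * D \<le> D"
      using p_le_1 p_pos D \<tau>_pos by (simp add: mult_left_le_one_le)
    ultimately show ?thesis
      using False s by linarith
  qed (use D in linarith)
  then have "(s / 8)\<^sup>2 \<le> D\<^sup>2"
    using s by (intro power_mono) auto
  with CS have "s\<^sup>2 * (1/64) \<le> s\<^sup>2 * (\<Sum>i=1..n. (cond_mean i)\<^sup>2)"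
    by (simp add: power_divide)
  then show ?thesis
    using s by simp
qed

text \<open>Under the product measure with mean \<open>cond_mean\<close> the linear form has expectation at least \<open>\<tau>\<close>, but
  it could exceed its expectation only rarely if some coordinates are almost deterministic.
  Freezing every coordinate of bias more than 1/2 at its favourable sign removes this obstacle; it
  increases the expectation of the form, and the squared norm of the mean by a factor of at most 4.\<close>

lemma log_inverse_probability_le: "ln (1 / p) \<le> 4 * (\<Sum>i=1..n. (cond_mean i)\<^sup>2) + 6"
proof -
  define S where "S = (\<Sum>i=1..n. (cond_mean i)\<^sup>2)"
  define m where "m i = (if \<bar>cond_mean i\<bar> \<le> 1/2 then cond_mean i else if 0 \<le> a i then 1 else -1)" for i
  have m: "\<bar>m i\<bar> \<le> 1/2 \<or> \<bar>m i\<bar> = 1" for i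
    by (simp add: m_def)
  have m1: "\<bar>m i\<bar> \<le> 1" for i
    by (simp add: m_def)
  have "a i * cond_mean i \<le> a i * m i" if "i \<in> {1..n}" for i
    using abs_cond_mean_le_1 [OF that]
    by (auto simp: m_def abs_le_iff intro: mult_left_mono mult_left_mono_neg
        dest: mult_left_mono [of "cond_mean i" 1 "a i"] mult_left_mono_neg [of "-1" "cond_mean i" "a i"])
  then have "(\<Sum>i=1..n. a i * cond_mean i) \<le> (\<Sum>i=1..n. a i * m i)"
    by (rule sum_mono)
  with threshold_le_cond_mean_dot have "\<tau> \<le> (\<Sum>i=1..n. a i * m i)"
    by linarith
  then have "of_bool (0 \<le> centred_form n a m x) \<le> F x" if "x \<in> cube n" for x
    by (auto simp: F_eq [OF that] centred_form_def right_diff_distrib sum_subtractf)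
  then have "biased_expect n m (\<lambda>x. of_bool (0 \<le> centred_form n a m x)) \<le> biased_expect n m F"
    by (intro biased_expect_mono m1)
  with biased_nonneg_probability [of n m a, OF m] have "5/36 \<le> biased_expect n m F"
    by linarith
  then have "(5/36)\<^sup>2 \<le> (biased_expect n m F)\<^sup>2"
    by (intro power_mono) auto
  also have "\<dots> \<le> cube_expect n (\<lambda>x. (F x)\<^sup>2) * exp (\<Sum>i=1..n. (m i)\<^sup>2)"
    by (rule biased_expect_Cauchy_Schwarz)
  also have "cube_expect n (\<lambda>x. (F x)\<^sup>2) = p"
    unfolding p_eq by (rule cube_expect_cong) (simp add: F_eq)
  also have "(\<Sum>i=1..n. (m i)\<^sup>2) \<le> 4 * S"
    unfolding S_def sum_distrib_left
  proof (rule sum_mono)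
    fix i
    show "(m i)\<^sup>2 \<le> 4 * (cond_mean i)\<^sup>2"
    proof (cases "\<bar>cond_mean i\<bar> \<le> 1/2")
      case False
      then have "(1/2)\<^sup>2 \<le> \<bar>cond_mean i\<bar>\<^sup>2"
        by (intro power_mono) auto
      then show ?thesis
        by (simp add: m_def power2_eq_square)
    qed (simp add: m_def)
  qed
  finally have "(5/36)\<^sup>2 \<le> p * exp (4 * S)"
    using p_pos by simp
  moreover have "(2::real) ^ 6 \<le> exp 1 ^ 6"
    by (rule power_mono) (use exp_ge_add_one_self [of 1] in auto)
  then have "64 \<le> exp (6::real)"
    by (simp flip: exp_of_nat_mult)
  then have "1 / exp 6 \<le> (5/36 :: real)\<^sup>2"
    by (simp add: field_simps power2_eq_square)
  ultimately have "exp (-6) \<le> p * exp (4 * S)"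
    by (simp add: exp_minus inverse_eq_divide)
  then have "-6 \<le> ln (p * exp (4 * S))"
    using p_pos by (subst ln_ge_iff) auto
  then show ?thesis
    using p_pos by (simp add: ln_mult ln_div S_def)
qed

end

section \<open>Conclusion\<close>

text \<open>With \<open>l = ln (e / (p\<^sup>2 S))\<close> the claims read \<open>S \<le> 2 l\<close> and \<open>l \<le> 1224 S\<close>. The bounds on \<open>S\<close> imply
  \<open>p S \<le> 1\<close>, whence \<open>l \<ge> 1 + ln (1/p)\<close>, which exceeds \<open>S / 2\<close>. Conversely
  \<open>l \<le> 1 + 2 (4 S + 6) + 6 = 8 S + 19\<close>, and \<open>8 S + 19 \<le> (8 + 19 \<cdot> 64) S\<close> as \<open>S \<ge> 1/64\<close>; here
  \<open>ln (1/S) \<le> ln 64 \<le> 6\<close> was used.\<close>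

lemma phi_comparable_to_square:
  assumes p: "0 < p"
    and S: "1/64 \<le> S" "S \<le> 2 * ln (1 / p)" "ln (1 / p) \<le> 4 * S + 6"
  shows "1/2 * \<phi> (p\<^sup>2 * S) \<le> p\<^sup>2" and "p\<^sup>2 \<le> 1224 * \<phi> (p\<^sup>2 * S)"
proof -
  define l where "l = ln (exp 1 / (p\<^sup>2 * S))"
  have l: "l = 1 + 2 * ln (1 / p) - ln S"
    using p S by (simp add: l_def ln_div ln_mult ln_realpow)
  have "ln (1 / p / 2) \<le> 1 / p / 2 - 1" "ln (2::real) \<le> 2 - 1"
    by (rule ln_le_minus_one; use p in simp)+
  then have "2 * ln (1 / p) \<le> 1 / p"
    using p by (simp add: ln_div ln_mult)
  with S have "S \<le> 1 / p"
    by (blast intro: order_trans)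
  then have "ln S \<le> ln (1 / p)"
    using S p by (subst ln_le_cancel_iff) auto
  with S l have l1: "S \<le> 2 * l" "0 < l"
    by linarith+
  have "(2::real) ^ 6 \<le> exp 1 ^ 6"
    by (rule power_mono) (use exp_ge_add_one_self [of 1] in auto)
  then have "64 \<le> exp (6::real)"
    by (simp flip: exp_of_nat_mult)
  moreover have "1 / S \<le> 64"
    using S by (simp add: field_simps)
  ultimately have "1 / S \<le> exp 6"
    by linarith
  then have "ln (1 / S) \<le> ln (exp 6)"
    using S by (subst ln_le_cancel_iff) auto
  with S l have l2: "l \<le> 1224 * S"
    by (simp add: ln_div)
  have phi: "\<phi> (p\<^sup>2 * S) = p\<^sup>2 * S / l"
    using p S by (simp add: \<phi>_def l_def)
  show "1/2 * \<phi> (p\<^sup>2 * S) \<le> p\<^sup>2"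
    using mult_left_mono [OF l1(1), of "p\<^sup>2"] l1(2) unfolding phi by (simp add: field_simps)
  show "p\<^sup>2 \<le> 1224 * \<phi> (p\<^sup>2 * S)"
    using mult_left_mono [OF l2, of "p\<^sup>2"] l1(2) unfolding phi by (simp add: field_simps)
qed

lemma strict_threshold_eq_weak_threshold:
  fixes B :: "real set"
  assumes "finite B"
  shows "\<exists>\<tau>>t. \<forall>y\<in>B. t < y \<longleftrightarrow> \<tau> \<le> y"
proof (intro exI conjI ballI)
  let ?T = "insert (t + 1) {y \<in> B. t < y}"
  show "t < Min ?T"
    using assms by auto
  then show "t < y \<longleftrightarrow> Min ?T \<le> y" if "y \<in> B" for y
    using assms that by (auto intro!: Min_le simp: Min_le_iff)
qed

text \<open>The duality \<open>g(-x) = 1 - f(x)\<close>, from which the mean and the level-1 coefficients of \<open>g\<close> follow.\<close>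

lemma dual_halfspace_reflect:
  "dual_halfspace n a t (\<lambda>i\<in>{1..n}. - x i) = 1 - halfspace n a t x"
  by (auto simp: dual_halfspace_def halfspace_def sum_negf)

lemma cube_expect_dual_halfspace:
  "cube_expect n (dual_halfspace n a t) = 1 - cube_expect n (halfspace n a t)"
proof -
  have "cube_expect n (dual_halfspace n a t) = cube_expect n (\<lambda>x. 1 + (-1) * halfspace n a t x)"
    by (subst cube_expect_reflect [symmetric]) (simp only: dual_halfspace_reflect, simp)
  then show ?thesis
    unfolding cube_expect_add cube_expect_cmult by (simp add: cube_expect_const)
qed

lemma fourier1_dual_halfspace:
  assumes "i \<in> {1..n}"
  shows "fourier1 n (dual_halfspace n a t) i = fourier1 n (halfspace n a t) i"
proof -
  have "cube_expect n (\<lambda>x. x i) = cube_expect n (\<lambda>x. -1 * x i)"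
    using assms by (subst cube_expect_reflect [symmetric]) simp
  then have mean: "cube_expect n (\<lambda>x. x i) = 0"
    unfolding cube_expect_cmult by simp
  have "fourier1 n (dual_halfspace n a t) i
      = cube_expect n (\<lambda>x. halfspace n a t x * x i + (-1) * x i)"
    unfolding fourier1_def using assms
    by (subst cube_expect_reflect [symmetric]) (simp only: dual_halfspace_reflect, simp add: algebra_simps)
  then show ?thesis
    unfolding cube_expect_add cube_expect_cmult mean by (simp add: fourier1_def)
qed

text \<open>The two halfspaces are nested, so their product is the smaller one.\<close>

lemma cov_halfspace_dual_halfspace:
  fixes n a t
  defines "h \<equiv> (if 0 \<le> t then halfspace n a t else dual_halfspace n a t)"
  shows "cube_cov n (halfspace n a t) (dual_halfspace n a t) = (cube_expect n h)\<^sup>2"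
proof -
  have "halfspace n a t x * dual_halfspace n a t x = h x" for x
    by (auto simp: h_def halfspace_def dual_halfspace_def)
  then show ?thesis
    by (auto simp: cube_cov_def cube_expect_dual_halfspace h_def power2_eq_square algebra_simps)
qed

lemma smaller_halfspace_is_positive_threshold:
  fixes n a t
  defines "h \<equiv> (if 0 \<le> t then halfspace n a t else dual_halfspace n a t)"
  obtains \<tau> where "0 < \<tau>" "\<And>x. x \<in> cube n \<Longrightarrow> h x = of_bool (\<tau> \<le> (\<Sum>i=1..n. a i * x i))"
proof (cases "0 \<le> t")
  case True
  have "finite ((\<lambda>x. \<Sum>i=1..n. a i * x i) ` cube n)"
    by simp
  then obtain \<tau> where "t < \<tau>"
    "\<forall>y\<in>(\<lambda>x. \<Sum>i=1..n. a i * x i) ` cube n. t < y \<longleftrightarrow> \<tau> \<le> y"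
    using strict_threshold_eq_weak_threshold by blast
  with True show ?thesis
    by (intro that [of \<tau>]) (simp_all add: h_def halfspace_def)
next
  case False
  then show ?thesis
    by (intro that [of "-t"]) (simp_all add: h_def dual_halfspace_def)
qed

lemma cov_comparable_to_phi:
  fixes n a t
  defines "f \<equiv> halfspace n a t" and "g \<equiv> dual_halfspace n a t"
  defines "W \<equiv> \<Sum>i=1..n. fourier1 n f i * fourier1 n g i"
  shows "1/2 * \<phi> W \<le> cube_cov n f g" and "cube_cov n f g \<le> 1224 * \<phi> W"
proof -
  define h where "h = (if 0 \<le> t then f else g)"
  define p where "p = cube_expect n h"
  have cov: "cube_cov n f g = p\<^sup>2"
    using cov_halfspace_dual_halfspace [of n a t] by (simp add: f_def g_def h_def p_def)
  have W: "W = (\<Sum>i=1..n. (fourier1 n h i)\<^sup>2)"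
    unfolding W_def
    by (rule sum.cong) (auto simp: h_def f_def g_def fourier1_dual_halfspace power2_eq_square)
  obtain \<tau> where \<tau>: "0 < \<tau>" "\<And>x. x \<in> cube n \<Longrightarrow> h x = of_bool (\<tau> \<le> (\<Sum>i=1..n. a i * x i))"
    using smaller_halfspace_is_positive_threshold [of n t a] unfolding h_def f_def g_def by metis
  have h01: "0 \<le> h x \<and> h x \<le> 1" if "x \<in> cube n" for x
    using \<tau>(2) [OF that] by simp
  have "0 \<le> p"
    unfolding p_def cube_expect_eq_sum using h01 by (intro divide_nonneg_nonneg sum_nonneg) auto
  then consider "p = 0" | "p > 0"
    by linarith
  then have "1/2 * \<phi> W \<le> p\<^sup>2 \<and> p\<^sup>2 \<le> 1224 * \<phi> W"
  proof cases
    case 1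
    then have "h x = 0" if "x \<in> cube n" for x
      using that h01 by (simp add: p_def cube_expect_eq_sum sum_nonneg_eq_0_iff)
    then have "W = 0"
      by (simp add: W fourier1_def cube_expect_eq_sum)
    with 1 show ?thesis
      by (simp add: \<phi>_def)
  next
    case 2
    interpret positive_threshold n a \<tau> h p
      by unfold_locales (use \<tau> 2 in \<open>simp_all add: p_def\<close>)
    define S where "S = (\<Sum>i=1..n. (cond_mean i)\<^sup>2)"
    have "W = p\<^sup>2 * S"
      using 2 by (simp add: W S_def cond_mean_def sum_distrib_left power_divide)
    moreover have "S \<le> 2 * ln (1 / p)"
      unfolding S_def cond_mean_def using h01 p_def 2 by (rule level_one_inequality)
    ultimately show ?thesis
      using phi_comparable_to_square [OF 2, of S] cond_mean_norm_ge log_inverse_probability_le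
      by (simp add: S_def)
  qed
  then show "1/2 * \<phi> W \<le> cube_cov n f g" and "cube_cov n f g \<le> 1224 * \<phi> W"
    by (simp_all add: cov)
qed

theorem corollary1p2:
  shows "\<exists>c C :: real. 0 < c \<and> c \<le> C \<and>
    (\<forall>(n::nat) (a :: nat \<Rightarrow> real) (t :: real). 1 \<le> n \<longrightarrow>
      (let f = halfspace n a t;
           g = dual_halfspace n a t;
           W = (\<Sum>i = 1..n. fourier1 n f i * fourier1 n g i)
       in c * \<phi> W \<le> cube_cov n f g \<and> cube_cov n f g \<le> C * \<phi> W))"
  unfolding Let_def
  by (rule exI [of _ "1/2"], rule exI [of _ 1224]) (simp only: cov_comparable_to_phi, simp)

end
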